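(* Let $\succcurlyeq$ be a complete, transitive and weakly monotonic binary relation on $X=\mathbb{R}_+^n$, and let $P$ be any one of the following eight properties: graph continuous, continuous, arc-continuous, linearly continuous, mixture-continuous, Archimedean, Wold-continuous, weakly Wold-continuous. Then $\succcurlyeq$ is representable by a continuous utility function if and only if $\succcurlyeq$ satisfies $P$.
   Context: Representable by a continuous utility function: there is a continuous $u:X\to\mathbb{R}$ with $x\succcurlyeq y$ if and only if $u(x)\ge u(y)$ for all $x,y\in X$. $x\succ y$ iff $x\succcurlyeq y$ and not $y\succcurlyeq x$; $x\sim y$ iff $x\succcurlyeq y$ and $y\succcurlyeq x$; $x\preccurlyeq y$ iff $y\succcurlyeq x$; $x\prec y$ iff $y\succ x$. Complete: $x\succcurlyeq y$ or $y\succcurlyeq x$ for all $x,y\in X$. For $R\in\{\succcurlyeq,\preccurlyeq,\succ,\prec\}$, $A_R(x)=\{y\in X:y\,R\,x\}$. For $\lambda\in[0,1]$, $x\lambda y=\lambda x+(1-\lambda)y$. For vectors, $x>y$ means $x_i\ge y_i$ for every $i$ and $x\neq y$. Weakly monotonic: $x>y$ implies $x\succcurlyeq y$. For $S\subseteq X$, the restriction of $\succcurlyeq$ to $S$ is continuous if for all $x\in X$ (not only $x\in S$), $A_\succcurlyeq(x)\cap S$ and $A_\preccurlyeq(x)\cap S$ are closed in $S$, and $A_\succ(x)\cap S$ and $A_\prec(x)\cap S$ are open in $S$. Graph continuous: $\succcurlyeq$ is closed and $\succ$ is open in $X\times X$. Continuous: the restriction of $\succcurlyeq$ to $S=X$ is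 continuous. Arc-continuous: the restriction of $\succcurlyeq$ to every smooth curve in $X$ is continuous, where a smooth curve is the range of a continuously differentiable injective $m:[0,1]\to\mathbb{R}^n$ with $m'(\lambda)\ne0$ for all $\lambda\in[0,1]$. Linearly continuous: the restriction of $\succcurlyeq$ to every straight line in $X$ (intersection with $X$ of a one-dimensional affine subspace of $\mathbb{R}^n$) is continuous. Mixture-continuous: for all $x,y,z\in X$, $\{\lambda\in[0,1]:x\lambda y\succcurlyeq z\}$ and $\{\lambda\in[0,1]:x\lambda y\preccurlyeq z\}$ are closed. Archimedean: for all $x,y,z\in X$ with $x\succ y$ there exist $\lambda,\delta\in(0,1)$ with $x\lambda z\succ y$ and $x\succ y\delta z$. Order dense: $x\succ y$ implies that there exists $z\in X$ with $x\succ z\succ y$. Weakly Wold-continuous: order dense, and $x\succ z\succ y$ implies that the straight line segment joining $x$ to $y$ contains a point $w\sim z$. Wold-continuous: order dense, and $x\succ z\succ y$ implies that every curve in $X$ joining $x$ to $y$ (the range of a continuous injective function $m:[0,1]\to X$ with endpoints $x$ and $y$) contains a point $w\sim z$. *)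

theory Defs
  imports "HOL-Analysis.Analysis"
begin

text \<open>A binary relation on a set X is a predicate R, where R x y reads ``x is weakly preferred
  to y''. Only the values of R on X are ever used: every notion below is relativised to X.\<close>

definition complete_pref :: "'a set \<Rightarrow> ('a \<Rightarrow> 'a \<Rightarrow> bool) \<Rightarrow> bool" where
  "complete_pref X R \<longleftrightarrow> (\<forall>x\<in>X. \<forall>y\<in>X. R x y \<or> R y x)"

definition strict :: "('a \<Rightarrow> 'a \<Rightarrow> bool) \<Rightarrow> 'a \<Rightarrow> 'a \<Rightarrow> bool" where
  "strict R x y \<longleftrightarrow> R x y \<and> \<not> R y x"

definition indiff :: "('a \<Rightarrow> 'a \<Rightarrow> bool) \<Rightarrow> 'a \<Rightarrow> 'a \<Rightarrow> bool" where
  "indiff R x y \<longleftrightarrow> R x y \<and> R y x"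

definition nonneg_orthant :: "(real ^ 'n) set" where
  "nonneg_orthant = {x. \<forall>i. 0 \<le> x $ i}"

definition weakly_monotonic :: "(real ^ 'n) set \<Rightarrow> (real ^ 'n \<Rightarrow> real ^ 'n \<Rightarrow> bool) \<Rightarrow> bool" where
  "weakly_monotonic X R \<longleftrightarrow>
     (\<forall>x\<in>X. \<forall>y\<in>X. (\<forall>i. x $ i \<ge> y $ i) \<and> x \<noteq> y \<longrightarrow> R x y)"

definition utility_representable ::
  "'a::topological_space set \<Rightarrow> ('a \<Rightarrow> 'a \<Rightarrow> bool) \<Rightarrow> bool" where
  "utility_representable X R \<longleftrightarrow>
     (\<exists>u :: 'a \<Rightarrow> real. continuous_on X u \<and> (\<forall>x\<in>X. \<forall>y\<in>X. R x y \<longleftrightarrow> u x \<ge> u y))"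

definition section_at :: "'a set \<Rightarrow> ('a \<Rightarrow> 'a \<Rightarrow> bool) \<Rightarrow> 'a \<Rightarrow> 'a set" where
  "section_at X Q x = {y \<in> X. Q y x}"

text \<open>The reference point x ranges over all of X, not only over S.\<close>

definition continuous_restr ::
  "'a::topological_space set \<Rightarrow> ('a \<Rightarrow> 'a \<Rightarrow> bool) \<Rightarrow> 'a set \<Rightarrow> bool" where
  "continuous_restr X R S \<longleftrightarrow>
     (\<forall>x\<in>X. closedin (top_of_set S) (section_at X R x \<inter> S) \<and>
            closedin (top_of_set S) (section_at X (R\<inverse>\<inverse>) x \<inter> S) \<and>
            openin (top_of_set S) (section_at X (strict R) x \<inter> S) \<and>
            openin (top_of_set S) (section_at X ((strict R)\<inverse>\<inverse>) x \<inter> S))"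

definition graph_continuous ::
  "'a::topological_space set \<Rightarrow> ('a \<Rightarrow> 'a \<Rightarrow> bool) \<Rightarrow> bool" where
  "graph_continuous X R \<longleftrightarrow>
     closedin (top_of_set (X \<times> X)) {(x, y) \<in> X \<times> X. R x y} \<and>
     openin (top_of_set (X \<times> X)) {(x, y) \<in> X \<times> X. strict R x y}"

definition continuous_pref ::
  "'a::topological_space set \<Rightarrow> ('a \<Rightarrow> 'a \<Rightarrow> bool) \<Rightarrow> bool" where
  "continuous_pref X R \<longleftrightarrow> continuous_restr X R X"

text \<open>Derivatives are taken within the unit interval, hence one-sided at its endpoints, so that
  nothing is required of m outside the interval.\<close>

definition smooth_curve :: "'a::real_normed_vector set \<Rightarrow> bool" where
  "smooth_curve C \<longleftrightarrow>
     (\<exists>(m :: real \<Rightarrow> 'a) m'.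
        C = m ` {0..1} \<and> inj_on m {0..1} \<and> continuous_on {0..1} m' \<and>
        (\<forall>t\<in>{0..1}. (m has_vector_derivative m' t) (at t within {0..1}) \<and> m' t \<noteq> 0))"

definition arc_continuous ::
  "'a::real_normed_vector set \<Rightarrow> ('a \<Rightarrow> 'a \<Rightarrow> bool) \<Rightarrow> bool" where
  "arc_continuous X R \<longleftrightarrow> (\<forall>C. smooth_curve C \<and> C \<subseteq> X \<longrightarrow> continuous_restr X R C)"

definition linearly_continuous ::
  "'a::euclidean_space set \<Rightarrow> ('a \<Rightarrow> 'a \<Rightarrow> bool) \<Rightarrow> bool" where
  "linearly_continuous X R \<longleftrightarrow>
     (\<forall>L. affine L \<and> aff_dim L = 1 \<longrightarrow> continuous_restr X R (L \<inter> X))"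

definition mix :: "'a::real_vector \<Rightarrow> real \<Rightarrow> 'a \<Rightarrow> 'a" where
  "mix x t y = t *\<^sub>R x + (1 - t) *\<^sub>R y"

definition mixture_continuous ::
  "'a::real_vector set \<Rightarrow> ('a \<Rightarrow> 'a \<Rightarrow> bool) \<Rightarrow> bool" where
  "mixture_continuous X R \<longleftrightarrow>
     (\<forall>x\<in>X. \<forall>y\<in>X. \<forall>z\<in>X.
        closed {t \<in> {0..1}. R (mix x t y) z} \<and> closed {t \<in> {0..1}. R z (mix x t y)})"

definition archimedean_pref ::
  "'a::real_vector set \<Rightarrow> ('a \<Rightarrow> 'a \<Rightarrow> bool) \<Rightarrow> bool" where
  "archimedean_pref X R \<longleftrightarrow>
     (\<forall>x\<in>X. \<forall>y\<in>X. \<forall>z\<in>X. strict R x y \<longrightarrow>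
        (\<exists>s\<in>{0<..<1}. \<exists>t\<in>{0<..<1}. strict R (mix x s z) y \<and> strict R x (mix y t z)))"

definition order_dense :: "'a set \<Rightarrow> ('a \<Rightarrow> 'a \<Rightarrow> bool) \<Rightarrow> bool" where
  "order_dense X R \<longleftrightarrow>
     (\<forall>x\<in>X. \<forall>y\<in>X. strict R x y \<longrightarrow> (\<exists>z\<in>X. strict R x z \<and> strict R z y))"

definition weakly_wold_continuous ::
  "'a::real_vector set \<Rightarrow> ('a \<Rightarrow> 'a \<Rightarrow> bool) \<Rightarrow> bool" where
  "weakly_wold_continuous X R \<longleftrightarrow>
     order_dense X R \<and>
     (\<forall>x\<in>X. \<forall>y\<in>X. \<forall>z\<in>X. strict R x z \<and> strict R z y \<longrightarrow>
        (\<exists>w\<in>closed_segment x y. indiff R w z))"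

definition wold_continuous ::
  "'a::real_normed_vector set \<Rightarrow> ('a \<Rightarrow> 'a \<Rightarrow> bool) \<Rightarrow> bool" where
  "wold_continuous X R \<longleftrightarrow>
     order_dense X R \<and>
     (\<forall>x\<in>X. \<forall>y\<in>X. \<forall>z\<in>X. strict R x z \<and> strict R z y \<longrightarrow>
        (\<forall>m. arc m \<and> path_image m \<subseteq> X \<and> pathstart m = x \<and> pathfinish m = y \<longrightarrow>
           (\<exists>w\<in>path_image m. indiff R w z)))"

end

theory Submission
  imports Defs
begin

text \<open>Each of the eight properties is squeezed between continuous representability and the
  following radial property: if \<open>x \<succ> y\<close>, then \<open>s x \<succ> y\<close> for some \<open>s < 1\<close> and
  \<open>x \<succ> y + t (1, \<dots>, 1)\<close> for some \<open>t > 0\<close>. By weak monotonicity, the points of the orthant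
  that are componentwise above \<open>s x\<close>, respectively below \<open>y + t (1, \<dots>, 1)\<close>, form neighbourhoods
  of \<open>x\<close> and \<open>y\<close>, so the radial property already gives continuity. A continuous utility then
  exists by Debreu's theorem: on a connected space a continuous preference is order dense, so an
  Urysohn construction along a chain indexed by the dyadic rationals separates every strict pair
  from a countable dense set by a continuous monotone function, and a weighted sum of these
  functions is a utility.\<close>

section \<open>Debreu's representation theorem\<close>

text \<open>Once the mesh \<open>1 / 2 ^ k\<close> is finer than \<open>d - c\<close>, the first
  multiple of the mesh beyond \<open>c\<close> comes before \<open>d\<close>.\<close>

lemma dyadic_between:
  fixes c d :: real
  assumes "0 \<le> c" "c < d" "d \<le> 1"
  obtains q where "q \<in> dyadics \<inter> {0..1}" "c < q" "q < d"
proof -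
  obtain k :: nat where k: "1 / (d - c) < 2 ^ k"
    using real_arch_pow[of 2 "1 / (d - c)"] by auto
  \<comment> \<open>The summand \<open>1\<close> makes \<open>m\<close> the first integer strictly
    above \<open>c * 2 ^ k\<close>; \<open>nat\<close> does no harm since \<open>c\<close> is
    nonnegative.\<close>
  define m where "m = nat \<lfloor>c * 2 ^ k\<rfloor> + 1"
  have m: "c * 2 ^ k < real m" "real m \<le> c * 2 ^ k + 1"
    using assms(1) unfolding m_def by (auto simp: of_nat_nat) linarith+
  have "1 < (d - c) * 2 ^ k"
    using k assms by (simp add: field_simps)
  then have "real m < d * 2 ^ k"
    using m by (simp add: algebra_simps)
  then have "c < real m / 2 ^ k" "real m / 2 ^ k < d"
    using m by (simp_all add: field_simps)
  moreover have "real m / 2 ^ k \<in> dyadics"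
    by (auto simp: dyadics_def)
  moreover have "real m / 2 ^ k \<in> {0..1}"
    unfolding atLeastAtMost_iff using calculation assms by linarith
  ultimately show ?thesis
    using that by blast
qed

text \<open>With nothing strictly between \<open>x\<close> and \<open>y\<close>, the open sets of
  points above \<open>y\<close> and of points below \<open>x\<close> would be disjoint, and they
  would disconnect \<open>X\<close>.\<close>

lemma order_dense_connected:
  assumes "complete_pref X R" "transp_on X R" "connected X" "continuous_pref X R"
  shows "order_dense X R"
  unfolding order_dense_def
proof (intro ballI impI)
  fix x y assume x: "x \<in> X" and y: "y \<in> X" and xy: "strict R x y"
  let ?U = "section_at X (strict R) y" and ?V = "section_at X ((strict R)\<inverse>\<inverse>) x"
  have op: "openin (top_of_set X) ?U" "openin (top_of_set X) ?V"
    using assms(4) x y unfolding continuous_pref_def continuous_restr_def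
    by (metis (no_types, lifting) inf.absorb1 section_at_def mem_Collect_eq subsetI)+
  have ne: "?U \<noteq> {}" "?V \<noteq> {}"
    using x y xy by (auto simp: section_at_def)
  show "\<exists>z\<in>X. strict R x z \<and> strict R z y"
  proof (rule ccontr)
    assume none: "\<not> ?thesis"
    \<comment> \<open>A point that is not strictly above \<open>y\<close> is weakly below
      \<open>y\<close> by completeness, hence strictly below \<open>x\<close>.\<close>
    have "X \<subseteq> ?U \<union> ?V"
    proof
      fix z assume z: "z \<in> X"
      show "z \<in> ?U \<union> ?V"
        using assms(1)[unfolded complete_pref_def, rule_format, OF y z]
          assms(2)[unfolded transp_on_def, rule_format, OF y z x]
          assms(2)[unfolded transp_on_def, rule_format, OF x y z] z xy
        unfolding strict_def section_at_def by auto
    qed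
    moreover have "?U \<inter> ?V = {}"
      using none by (auto simp: section_at_def)
    ultimately show False
      using assms(3) op ne unfolding connected_openin by blast
  qed
qed

text \<open>This is Urysohn's construction with strict preference in the role of the inclusion of a
  closure in an open set. Order density provides the interpolation that builds a chain from
  \<open>a\<close> to \<open>b\<close> indexed by the dyadics of the unit interval.\<close>

lemma urysohn_pref:
  fixes X :: "'a::topological_space set"
  assumes "complete_pref X R" "transp_on X R" "continuous_pref X R" "order_dense X R"
    and "a \<in> X" "b \<in> X" "strict R b a"
  obtains g :: "'a \<Rightarrow> real"
  where "continuous_on X g" "\<And>x y. \<lbrakk>x \<in> X; y \<in> X; R x y\<rbrakk> \<Longrightarrow> g y \<le> g x"
    "\<And>x. x \<in> X \<Longrightarrow> g x \<in> {0..1}" "g a = 0" "g b = 1"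
proof -
  note cmp = assms(1)[unfolded complete_pref_def, rule_format]
    and trns = assms(2)[unfolded transp_on_def, rule_format]
  let ?D = "dyadics \<inter> {0..1::real}"
  \<comment> \<open>Membership in \<open>X\<close> is part of \<open>L\<close>, so that the chain
    produced by the recursion stays in \<open>X\<close>.\<close>
  define L where "L = (\<lambda>p q. p \<in> X \<and> q \<in> X \<and> strict R q p)"
  have "\<exists>f :: real \<Rightarrow> 'a. f 0 = a \<and> f 1 = b \<and> (\<forall>x\<in>?D. \<forall>y\<in>?D. x < y \<longrightarrow> L (f x) (f y))"
  proof (rule recursion_on_dyadic_fractions)
    show "L a b" using assms by (simp add: L_def)
    show "\<exists>z. L x z \<and> L z y" if "L x y" for x y
      using that assms(4) unfolding L_def order_dense_def by blast
    show "L x z" if "L x y" "L y z" for x y z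
      using that trns unfolding L_def strict_def by blast
  qed
  then obtain f where f: "f 0 = a" "f 1 = b" "\<And>x y. \<lbrakk>x \<in> ?D; y \<in> ?D; x < y\<rbrakk> \<Longrightarrow> L (f x) (f y)"
    by blast
  have D01: "0 \<in> ?D" "1 \<in> ?D"
    using real_in_dyadics[of 0] real_in_dyadics[of 1] by auto
  have fX: "f q \<in> X" if "q \<in> ?D" for q
    using that f(3)[OF that D01(2)] f(2) assms(6) unfolding L_def by (cases "q = 1") auto
  \<comment> \<open>\<open>Q x\<close> collects the levels that \<open>x\<close> weakly dominates.
    Inserting \<open>0\<close> keeps the supremum meaningful for points below the whole
    chain.\<close>
  define Q where "Q x = insert 0 {q \<in> ?D. R x (f q)}" for x
  define g where "g x = Sup (Q x)" for x
  have Q01: "Q x \<subseteq> {0..1}" "Q x \<noteq> {}" "bdd_above (Q x)" for x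
    unfolding Q_def by (auto intro: bdd_aboveI[of _ 1])
  have g01: "g x \<in> {0..1}" for x
    using Q01[of x] unfolding g_def
    by (auto intro!: cSup_least cSup_upper simp: Q_def)
  \<comment> \<open>A level \<open>r > q\<close> in \<open>Q x\<close> would put \<open>x\<close>
    weakly above \<open>f r\<close>, which is strictly above \<open>f q\<close>, contrary to
    \<open>f q\<close> being strictly above \<open>x\<close>.\<close>
  have upper: "g x \<le> q" if "x \<in> X" "q \<in> ?D" "strict R (f q) x" for x q
    unfolding g_def
  proof (rule cSup_least[OF Q01(2)])
    fix r assume r: "r \<in> Q x"
    show "r \<le> q"
    proof (rule ccontr)
      assume "\<not> r \<le> q"
      then have "r \<in> ?D" "R x (f r)" "q < r"
        using r that(2) unfolding Q_def by auto
      then show False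
        using f(3)[OF that(2), of r] that trns[of "x" "f r" "f q"] fX unfolding L_def strict_def
        by blast
    qed
  qed
  have lower: "q \<le> g x" if "q \<in> ?D" "R x (f q)" for x q
    using that Q01(3) unfolding g_def by (intro cSup_upper) (auto simp: Q_def)
  have op: "openin (top_of_set X) {y \<in> X. strict R y x}" "openin (top_of_set X) {y \<in> X. strict R x y}"
    if "x \<in> X" for x
  proof -
    have "section_at X (strict R) x \<inter> X = {y \<in> X. strict R y x}"
      "section_at X ((strict R)\<inverse>\<inverse>) x \<inter> X = {y \<in> X. strict R x y}"
      by (auto simp: section_at_def)
    then show "openin (top_of_set X) {y \<in> X. strict R y x}" "openin (top_of_set X) {y \<in> X. strict R x y}"
      using assms(3) that unfolding continuous_pref_def continuous_restr_def by metis+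
  qed
  have ev: "eventually P (at x within X)"
    if "openin (top_of_set X) S" "x \<in> S" "\<And>y. y \<in> S \<Longrightarrow> P y" for P x S
    using that unfolding openin_open eventually_at_topological by blast
  have "(g \<longlongrightarrow> g x) (at x within X)" if x: "x \<in> X" for x
  proof (rule order_tendstoI)
    fix c assume c: "g x < c"
    show "eventually (\<lambda>y. g y < c) (at x within X)"
    proof (cases "c \<le> 1")
      case True
      \<comment> \<open>All points strictly below \<open>f q\<close> have value at most
        \<open>q < c\<close>, and they form an open set containing \<open>x\<close>.\<close>
      then obtain q where q: "q \<in> ?D" "g x < q" "q < c"
        using dyadic_between[of "g x" c] g01[of x] c by auto
      have "strict R (f q) x"
        using lower[OF q(1), of x] q(2) cmp[OF x fX[OF q(1)]] unfolding strict_def by auto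
      then show ?thesis
        using upper[OF _ q(1)] q(3) x by (intro ev[OF op(2)[OF fX[OF q(1)]]]) force+
    next
      case False
      have "g y < c" for y using g01[of y] False by simp
      then show ?thesis by simp
    qed
  next
    fix c assume c: "c < g x"
    show "eventually (\<lambda>y. c < g y) (at x within X)"
    proof (cases "0 \<le> c")
      case True
      then obtain q where q: "q \<in> ?D" "c < q" "q < g x"
        using dyadic_between[of c "g x"] g01[of x] c by auto
      \<comment> \<open>A second level is inserted because \<open>r < g x\<close> yields only weak
        preference of \<open>x\<close> over \<open>f r\<close>. Strict preference over the lower
        point \<open>f q\<close> then puts \<open>x\<close> into an open set.\<close>
      obtain r where r: "r \<in> ?D" "q < r" "r < g x"
        using dyadic_between[of q "g x"] g01[of x] q by auto
      have "R x (f r)"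
        using upper[OF x r(1)] r(3) cmp[OF x fX[OF r(1)]] unfolding strict_def by auto
      moreover have "L (f q) (f r)" by (rule f(3)) (use q r in auto)
      ultimately have "strict R x (f q)"
        using trns x unfolding L_def strict_def by blast
      moreover have "c < g y" if "y \<in> {y \<in> X. strict R y (f q)}" for y
        using lower[OF q(1), of y] q(2) that unfolding strict_def by auto
      ultimately show ?thesis
        using x by (intro ev[OF op(1)[OF fX[OF q(1)]]]) auto
    next
      case False
      have "c < g y" for y using g01[of y] False by simp
      then show ?thesis by simp
    qed
  qed
  then have "continuous_on X g" by (simp add: continuous_on_def)
  moreover have "g y \<le> g x" if "x \<in> X" "y \<in> X" "R x y" for x y
    unfolding g_def
  proof (rule cSup_subset_mono[OF Q01(2) Q01(3)])
    show "Q y \<subseteq> Q x"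
      using trns[OF that(1,2) fX that(3)] unfolding Q_def by blast
  qed
  moreover have "g a = 0"
  proof -
    have "q = 0" if "q \<in> ?D" "R a (f q)" for q
    proof (rule ccontr)
      assume "q \<noteq> 0"
      then have "L a (f q)" using f(3)[OF D01(1) that(1)] that(1) f(1) by simp
      then show False using that(2) unfolding L_def strict_def by blast
    qed
    then have "Q a = {0}" unfolding Q_def by auto
    then show ?thesis by (simp add: g_def)
  qed
  moreover have "g b = 1"
    using lower[OF D01(2), of b] g01[of b] cmp[of b b] assms(6) f(2) by auto
  ultimately show ?thesis using g01 that by blast
qed

text \<open>Each function separating a pair of points of \<open>D\<close> is monotone, so the
  weighted sum is monotone. It is strictly larger at \<open>y\<close> than at \<open>x\<close> when
  \<open>y\<close> is strictly preferred, because some pair of points of \<open>D\<close> lies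
  strictly between them and the corresponding term jumps from 0 to 1.\<close>

lemma debreu:
  fixes X D :: "'a::topological_space set"
  assumes "complete_pref X R" "transp_on X R" "connected X" "continuous_pref X R"
    and "countable D" "D \<subseteq> X" "X \<subseteq> closure D"
  shows "utility_representable X R"
proof -
  note cmp = assms(1)[unfolded complete_pref_def, rule_format]
    and trns = assms(2)[unfolded transp_on_def, rule_format]
  have dense: "order_dense X R" by (rule order_dense_connected) fact+
  have "\<exists>g :: 'a \<Rightarrow> real. continuous_on X g \<and> (\<forall>x\<in>X. \<forall>y\<in>X. R x y \<longrightarrow> g y \<le> g x) \<and>
      (\<forall>x\<in>X. g x \<in> {0..1}) \<and> (fst i \<in> X \<and> snd i \<in> X \<and> strict R (snd i) (fst i) \<longrightarrow>
        g (fst i) = 0 \<and> g (snd i) = 1)" for i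
  proof (cases "fst i \<in> X \<and> snd i \<in> X \<and> strict R (snd i) (fst i)")
    case True
    then show ?thesis
      using urysohn_pref[OF assms(1,2,4) dense, of "fst i" "snd i"] by metis
  next
    case False
    \<comment> \<open>Pairs without strict preference receive the zero function, so that
      \<open>G\<close> is continuous and monotone at every index.\<close>
    then show ?thesis by (intro exI[of _ "\<lambda>_. 0"]) auto
  qed
  then obtain G :: "'a \<times> 'a \<Rightarrow> 'a \<Rightarrow> real" where G: "\<And>i. continuous_on X (G i)"
    "\<And>i x y. \<lbrakk>x \<in> X; y \<in> X; R x y\<rbrakk> \<Longrightarrow> G i y \<le> G i x"
    "\<And>i x. x \<in> X \<Longrightarrow> G i x \<in> {0..1}"
    "\<And>p q. \<lbrakk>p \<in> X; q \<in> X; strict R q p\<rbrakk> \<Longrightarrow> G (p, q) p = 0 \<and> G (p, q) q = 1"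
    by (metis fst_conv snd_conv)
  \<comment> \<open>The enumeration may repeat pairs, or return an arbitrary one if \<open>D\<close>
    is empty; either way each term is continuous, monotone and bounded by 1 on
    \<open>X\<close>.\<close>
  define h where "h k = G (from_nat_into (D \<times> D) k)" for k
  define u where "u x = (\<Sum>k. (1/2) ^ k * h k x)" for x
  have nrm: "norm ((1/2) ^ k * h k x) \<le> (1/2) ^ k" if "x \<in> X" for k x
    using G(3)[OF that] by (auto simp: h_def abs_mult intro: mult_left_le)
  have sm: "summable (\<lambda>k. (1/2) ^ k * h k x)" if "x \<in> X" for x
    by (rule summable_comparison_test'[OF summable_geometric[of "1/2"]]) (use nrm that in auto)
  have "continuous_on X u"
  proof (rule uniform_limit_theorem)
    show "uniform_limit X (\<lambda>n x. \<Sum>k<n. (1/2) ^ k * h k x) u sequentially"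
      unfolding u_def by (rule Weierstrass_m_test[OF nrm]) auto
    show "eventually (\<lambda>n. continuous_on X (\<lambda>x. \<Sum>k<n. (1/2) ^ k * h k x)) sequentially"
      by (intro always_eventually allI continuous_intros) (simp add: h_def G(1))
  qed simp
  moreover have "u y \<le> u x" if "x \<in> X" "y \<in> X" "R x y" for x y
    unfolding u_def by (intro suminf_le sm mult_left_mono that) (auto simp: h_def G(2) that)
  moreover have "u x < u y" if xy: "x \<in> X" "y \<in> X" "\<not> R x y" for x y
  proof -
    \<comment> \<open>The points strictly between \<open>a\<close> and \<open>b\<close> form a
      relatively open set, nonempty by order density, so the dense set \<open>D\<close> meets
      it.\<close>
    have between: "\<exists>p\<in>D. strict R b p \<and> strict R p a" if ab: "a \<in> X" "b \<in> X" "strict R b a" for a b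
    proof -
      let ?U = "section_at X (strict R) a \<inter> X \<inter> (section_at X ((strict R)\<inverse>\<inverse>) b \<inter> X)"
      have "openin (top_of_set X) ?U"
        using assms(4) ab unfolding continuous_pref_def continuous_restr_def by blast
      then obtain T where T: "open T" "?U = X \<inter> T" by (auto simp: openin_open)
      obtain z where "z \<in> X" "strict R b z" "strict R z a"
        using dense ab unfolding order_dense_def by blast
      then have "z \<in> T" using T(2) by (auto simp: section_at_def)
      then have "T \<inter> closure D \<noteq> {}" using \<open>z \<in> X\<close> assms(7) by auto
      then have "T \<inter> D \<noteq> {}" using open_Int_closure_eq_empty[OF T(1)] by auto
      then obtain p where "p \<in> D" "p \<in> X \<inter> T" using assms(6) by auto
      then show ?thesis unfolding T(2)[symmetric] by (auto simp: section_at_def)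
    qed
    have "strict R y x" using xy cmp unfolding strict_def by blast
    then obtain p where p: "p \<in> D" "strict R y p" "strict R p x"
      using between[of x y] xy by blast
    \<comment> \<open>With \<open>p\<close> above \<open>x\<close> and \<open>q\<close> between
      \<open>p\<close> and \<open>y\<close>, the function of the pair \<open>(p, q)\<close> is at
      most 0 at \<open>x\<close> and at least 1 at \<open>y\<close>.\<close>
    then obtain q where q: "q \<in> D" "strict R y q" "strict R q p"
      using between[of p y] xy assms(6) by blast
    have X: "p \<in> X" "q \<in> X" using p q assms(6) by auto
    obtain k where "from_nat_into (D \<times> D) k = (p, q)"
      using from_nat_into_surj[of "D \<times> D" "(p, q)"] p q assms(5) by auto
    then have k: "h k = G (p, q)" by (simp add: h_def)
    have "h k x \<le> 0" "1 \<le> h k y"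
      using G(2)[of p x "(p, q)"] G(2)[of y q "(p, q)"] G(4)[of p q] p q X xy
      unfolding k strict_def by auto
    then have pos: "0 < (1/2) ^ k * h k y - (1/2) ^ k * h k x" by simp
    have "0 \<le> (1/2) ^ j * h j y - (1/2) ^ j * h j x" for j
      using G(2)[of y x] xy \<open>strict R y x\<close> unfolding h_def strict_def by (simp add: mult_left_mono)
    then have "0 < (\<Sum>j. (1/2) ^ j * h j y - (1/2) ^ j * h j x)"
      using pos by (intro suminf_pos2[where i = k] summable_diff sm xy) auto
    then show ?thesis
      unfolding u_def using suminf_diff[OF sm[OF xy(2)] sm[OF xy(1)]] by simp
  qed
  ultimately show ?thesis
    unfolding utility_representable_def by (intro exI[of _ u]) (metis leD)
qed

section \<open>From utility to the continuity properties\<close>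

text \<open>The two graphs are the preimages of a closed and an open half-line under the continuous
  difference of utilities.\<close>

lemma utility_imp_graph_continuous:
  assumes "utility_representable X R"
  shows "graph_continuous X R"
proof -
  obtain u :: "'a \<Rightarrow> real"
    where u: "continuous_on X u" "\<And>x y. \<lbrakk>x \<in> X; y \<in> X\<rbrakk> \<Longrightarrow> R x y \<longleftrightarrow> u x \<ge> u y"
    using assms unfolding utility_representable_def by blast
  let ?d = "\<lambda>z. u (fst z) - u (snd z)"
  have c: "continuous_on (X \<times> X) ?d"
    by (intro continuous_intros continuous_on_compose2[OF u(1)]) auto
  have "{(x, y) \<in> X \<times> X. R x y} = X \<times> X \<inter> ?d -` {0..}"
    "{(x, y) \<in> X \<times> X. strict R x y} = X \<times> X \<inter> ?d -` {0<..}"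
    using u(2) by (auto simp: strict_def)
  then show ?thesis
    unfolding graph_continuous_def
    using continuous_closedin_preimage[OF c, of "{0..}"] continuous_openin_preimage_gen[OF c, of "{0<..}"]
    by simp
qed

text \<open>Both halves are the intermediate value theorem for \<open>u\<close> on a connected set:
  the average of two utilities is attained on the segment, and the utility of \<open>z\<close> is
  attained on the arc.\<close>

lemma utility_imp_wold_continuous:
  fixes X :: "'a::real_normed_vector set"
  assumes "utility_representable X R" "convex X"
  shows "wold_continuous X R"
proof -
  obtain u :: "'a \<Rightarrow> real"
    where u: "continuous_on X u" "\<And>x y. \<lbrakk>x \<in> X; y \<in> X\<rbrakk> \<Longrightarrow> R x y \<longleftrightarrow> u x \<ge> u y"
    using assms unfolding utility_representable_def by blast
  have ivt: "\<exists>w\<in>S. u w = c"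
    if "connected S" "S \<subseteq> X" "x \<in> S" "y \<in> S" "u y \<le> c" "c \<le> u x" for S x y c
  proof -
    have "connected (u ` S)"
      using that u(1) by (intro connected_continuous_image) (auto intro: continuous_on_subset)
    then have "c \<in> u ` S"
      using that by (meson connected_iff_interval imageI)
    then show ?thesis by auto
  qed
  have "\<exists>z\<in>X. strict R x z \<and> strict R z y" if "x \<in> X" "y \<in> X" "strict R x y" for x y
  proof -
    have "u y < u x" using that u(2) by (auto simp: strict_def)
    then have "\<exists>w\<in>closed_segment x y. u w = (u x + u y) / 2"
      using assms(2) that by (intro ivt[of _ x y] closed_segment_subset) auto
    then obtain w where "w \<in> closed_segment x y" "u w = (u x + u y) / 2" by blast
    then show ?thesis
      using closed_segment_subset[of x X y] assms(2) that u(2) \<open>u y < u x\<close>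
      by (intro bexI[of _ w]) (auto simp: strict_def)
  qed
  moreover have "\<exists>w\<in>path_image m. indiff R w z"
    if "x \<in> X" "y \<in> X" "z \<in> X" "strict R x z" "strict R z y" "arc m" "path_image m \<subseteq> X"
      "pathstart m = x" "pathfinish m = y" for x y z m
  proof -
    have "\<exists>w\<in>path_image m. u w = u z"
      by (rule ivt[of _ x y])
        (use that u(2) in \<open>auto simp: strict_def arc_def intro: connected_path_image\<close>)
    then show ?thesis using that u(2) unfolding indiff_def by (metis order_refl subsetD)
  qed
  ultimately show ?thesis
    unfolding wold_continuous_def order_dense_def by blast
qed

section \<open>Comparison of the continuity properties\<close>

text \<open>The reference points range over \<open>X\<close> in both cases, so only the subspace
  shrinks, and traces of closed and open sets remain closed and open.\<close>

lemma continuous_restr_subset: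
  assumes "continuous_restr X R T" "S \<subseteq> T"
  shows "continuous_restr X R S"
proof -
  have "closedin (top_of_set S) (A \<inter> S)" if "closedin (top_of_set T) (A \<inter> T)" for A
  proof -
    obtain C where "closed C" "A \<inter> T = T \<inter> C" using \<open>closedin _ _\<close> by (auto simp: closedin_closed)
    then show ?thesis using assms(2) unfolding closedin_closed by (intro exI[of _ C]) blast
  qed
  moreover have "openin (top_of_set S) (A \<inter> S)" if "openin (top_of_set T) (A \<inter> T)" for A
  proof -
    obtain C where "open C" "A \<inter> T = T \<inter> C" using \<open>openin _ _\<close> by (auto simp: openin_open)
    then show ?thesis using assms(2) unfolding openin_open by (intro exI[of _ C]) blast
  qed
  ultimately show ?thesis
    using assms(1) unfolding continuous_restr_def by blast
qed

text \<open>The sections at \<open>x\<close> are preimages of the two graphs under the embeddings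
  that fix one coordinate at \<open>x\<close>.\<close>

lemma graph_continuous_imp_continuous:
  fixes X :: "'a::topological_space set"
  assumes "graph_continuous X R"
  shows "continuous_pref X R"
  unfolding continuous_pref_def continuous_restr_def
proof (intro ballI)
  fix x assume x: "x \<in> X"
  let ?C = "{(x, y) \<in> X \<times> X. R x y}" and ?O = "{(x, y) \<in> X \<times> X. strict R x y}"
  have c: "closedin (top_of_set X) (X \<inter> f -` ?C)" and o: "openin (top_of_set X) (X \<inter> f -` ?O)"
    if "f = (\<lambda>y. (y, x)) \<or> f = (\<lambda>y. (x, y))" for f
  proof -
    have "continuous_on X f" "f \<in> X \<rightarrow> X \<times> X"
      using that x by (auto intro: continuous_intros)
    then show "closedin (top_of_set X) (X \<inter> f -` ?C)" "openin (top_of_set X) (X \<inter> f -` ?O)"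
      using assms unfolding graph_continuous_def
      by (blast intro: continuous_closedin_preimage_gen continuous_openin_preimage)+
  qed
  have "section_at X R x \<inter> X = X \<inter> (\<lambda>y. (y, x)) -` ?C"
    "section_at X (R\<inverse>\<inverse>) x \<inter> X = X \<inter> (\<lambda>y. (x, y)) -` ?C"
    "section_at X (strict R) x \<inter> X = X \<inter> (\<lambda>y. (y, x)) -` ?O"
    "section_at X ((strict R)\<inverse>\<inverse>) x \<inter> X = X \<inter> (\<lambda>y. (x, y)) -` ?O"
    using x by (auto simp: section_at_def)
  then show "closedin (top_of_set X) (section_at X R x \<inter> X) \<and>
      closedin (top_of_set X) (section_at X (R\<inverse>\<inverse>) x \<inter> X) \<and>
      openin (top_of_set X) (section_at X (strict R) x \<inter> X) \<and>
      openin (top_of_set X) (section_at X ((strict R)\<inverse>\<inverse>) x \<inter> X)"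
    using c o by presburger
qed

lemma continuous_imp_arc_continuous:
  "continuous_pref X R \<Longrightarrow> arc_continuous X R"
  unfolding continuous_pref_def arc_continuous_def by (blast intro: continuous_restr_subset)

lemma continuous_imp_linearly_continuous:
  "continuous_pref X R \<Longrightarrow> linearly_continuous X R"
  unfolding continuous_pref_def linearly_continuous_def by (blast intro: continuous_restr_subset)

lemma mix_in_segment: "t \<in> {0..1} \<Longrightarrow> mix x t y \<in> closed_segment x y"
  \<comment> \<open>\<open>mix\<close> puts the parameter on the first point,
    \<open>closed_segment\<close> on the second, hence \<open>1 - t\<close>.\<close>
  unfolding closed_segment_def mix_def by (auto intro!: exI[of _ "1 - t"])

text \<open>This is the common core of the arc and the line case: the sets of parameters are
  preimages of closed sections under the parametrization of the segment. A degenerate segment is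
  neither a smooth curve nor does it span a line, so \<open>x = y\<close> is treated apart, where
  the mixture is constant.\<close>

lemma segment_continuous_imp_mixture_continuous:
  fixes X :: "'a::real_normed_vector set"
  assumes "convex X"
    and seg: "\<And>x y. \<lbrakk>x \<in> X; y \<in> X; x \<noteq> y\<rbrakk> \<Longrightarrow> continuous_restr X R (closed_segment x y)"
  shows "mixture_continuous X R"
  unfolding mixture_continuous_def
proof (intro ballI)
  fix x y z assume X: "x \<in> X" "y \<in> X" "z \<in> X"
  show "closed {t \<in> {0..1}. R (mix x t y) z} \<and> closed {t \<in> {0..1}. R z (mix x t y)}"
  proof (cases "x = y")
    case True
    have "mix x t x = x" for t by (simp add: mix_def flip: scaleR_add_left)
    moreover have "closed {t \<in> {0..1::real}. b}" for b :: bool by (cases b) (simp_all flip: atLeastAtMost_iff)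
    ultimately show ?thesis using True by simp
  next
    case False
    let ?S = "closed_segment x y" and ?f = "\<lambda>t. mix x t y"
    have sub: "?S \<subseteq> X" using X assms(1) closed_segment_subset by blast
    have f: "continuous_on {0..1} ?f" "?f \<in> {0..1} \<rightarrow> ?S"
      by (simp add: mix_def continuous_intros) (rule Pi_I, rule mix_in_segment)
    have pre: "closed ({0..1} \<inter> ?f -` C)" if "closedin (top_of_set ?S) C" for C
      using continuous_closedin_preimage_gen[OF f that] closedin_closed_trans by blast
    have eq: "{t \<in> {0..1}. Q (mix x t y) z} = {0..1} \<inter> ?f -` (section_at X Q z \<inter> ?S)" for Q
      using sub mix_in_segment[of _ x y] by (auto simp: section_at_def)
    have "closedin (top_of_set ?S) (section_at X R z \<inter> ?S)"
      "closedin (top_of_set ?S) (section_at X (R\<inverse>\<inverse>) z \<inter> ?S)"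
      using seg[OF X(1,2) False] X(3) unfolding continuous_restr_def by blast+
    from this[THEN pre] show ?thesis
      unfolding eq[symmetric] by simp
  qed
qed

lemma smooth_curve_closed_segment:
  assumes "x \<noteq> y"
  shows "smooth_curve (closed_segment x y)"
  unfolding smooth_curve_def
proof (rule exI[of _ "linepath x y"], rule exI[of _ "\<lambda>_. y - x"], intro conjI ballI)
  show "closed_segment x y = linepath x y ` {0..1}"
    using path_image_linepath[of x y] by (simp add: path_image_def)
  show "inj_on (linepath x y) {0..1}"
    using arc_linepath[OF assms] by (simp add: arc_def)
  fix t :: real
  show "(linepath x y has_vector_derivative y - x) (at t within {0..1})"
    by (rule has_vector_derivative_linepath_within)
qed (use assms in auto)

lemma arc_continuous_imp_mixture_continuous:
  assumes "arc_continuous X R" "convex X"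
  shows "mixture_continuous X R"
  using assms smooth_curve_closed_segment closed_segment_subset
  unfolding arc_continuous_def by (intro segment_continuous_imp_mixture_continuous) blast+

lemma linearly_continuous_imp_mixture_continuous:
  assumes "linearly_continuous X R" "convex X"
  shows "mixture_continuous X R"
proof (rule segment_continuous_imp_mixture_continuous)
  fix x y assume "x \<in> X" "y \<in> X" "x \<noteq> y"
  then have "continuous_restr X R (affine hull {x, y} \<inter> X)"
    using assms(1) unfolding linearly_continuous_def by (simp add: aff_dim_2)
  moreover have "closed_segment x y \<subseteq> affine hull {x, y} \<inter> X"
    using \<open>x \<in> X\<close> \<open>y \<in> X\<close> assms(2) closed_segment_subset
    by (metis Int_subset_iff convex_hull_subset_affine_hull segment_convex_hull)
  ultimately show "continuous_restr X R (closed_segment x y)"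
    by (rule continuous_restr_subset)
qed fact

text \<open>The parameters at which the desired strict preference fails form a closed set without 1,
  so it misses some parameter slightly below 1.\<close>

lemma mixture_continuous_imp_archimedean:
  assumes "complete_pref X R" "mixture_continuous X R" "convex X"
  shows "archimedean_pref X R"
  unfolding archimedean_pref_def
proof (intro ballI impI)
  fix x y z assume X: "x \<in> X" "y \<in> X" "z \<in> X" and xy: "strict R x y"
  have ex: "\<exists>s\<in>{0<..<1}. s \<notin> S" if S: "closed S" "1 \<notin> S" for S :: "real set"
  proof -
    obtain e where "e > 0" and e: "ball 1 e \<subseteq> - S"
      using S by (metis ComplI open_Compl open_contains_ball)
    \<comment> \<open>Halving \<open>e\<close> keeps the point inside the ball and below 1; the
      maximum with \<open>1 / 2\<close> keeps it positive when \<open>e\<close> is large.\<close>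
    let ?s = "max (1 - e / 2) (1 / 2)"
    have "?s \<in> ball 1 e" using \<open>e > 0\<close> by (auto simp: dist_real_def)
    then show ?thesis using e \<open>e > 0\<close> by (intro bexI[of _ ?s]) auto
  qed
  have mX: "mix a t b \<in> X" if "a \<in> X" "b \<in> X" "t \<in> {0<..<1}" for a b t
    using that assms(3) mix_in_segment[of t a b] closed_segment_subset[of a X b] by auto
  have "\<exists>s\<in>{0<..<1}. s \<notin> {t \<in> {0..1}. R y (mix x t z)}"
    using assms(2) X xy by (intro ex) (auto simp: mixture_continuous_def mix_def strict_def)
  moreover have "\<exists>t\<in>{0<..<1}. t \<notin> {t \<in> {0..1}. R (mix y t z) x}"
    using assms(2) X xy by (intro ex) (auto simp: mixture_continuous_def mix_def strict_def)
  ultimately obtain s t where st: "s \<in> {0<..<1}" "\<not> R y (mix x s z)"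
      "t \<in> {0<..<1}" "\<not> R (mix y t z) x"
    by auto
  have "strict R a b" if "a \<in> X" "b \<in> X" "\<not> R b a" for a b
    using that assms(1) by (auto simp: complete_pref_def strict_def)
  then show "\<exists>s\<in>{0<..<1}. \<exists>t\<in>{0<..<1}. strict R (mix x s z) y \<and> strict R x (mix y t z)"
    using mX X st by blast
qed

text \<open>A segment with distinct endpoints is an arc, and the strict preferences through
  \<open>z\<close> force the endpoints to differ.\<close>

lemma wold_imp_weakly_wold:
  assumes "wold_continuous X R" "convex X"
  shows "weakly_wold_continuous X R"
  unfolding weakly_wold_continuous_def
proof (intro conjI ballI impI)
  show "order_dense X R" using assms(1) by (simp add: wold_continuous_def)
  fix x y z assume X: "x \<in> X" "y \<in> X" "z \<in> X" and xyz: "strict R x z \<and> strict R z y"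
  then have "x \<noteq> y" by (auto simp: strict_def)
  then have "arc (linepath x y)" by (rule arc_linepath)
  moreover have "path_image (linepath x y) \<subseteq> X"
    using X assms(2) by (simp add: closed_segment_subset)
  ultimately show "\<exists>w\<in>closed_segment x y. indiff R w z"
    using assms(1) X xyz unfolding wold_continuous_def
    by (metis path_image_linepath pathfinish_linepath pathstart_linepath)
qed

section \<open>The radial property on the nonnegative orthant\<close>

lemma convex_nonneg_orthant: "convex (nonneg_orthant :: (real ^ 'n) set)"
  unfolding convex_def nonneg_orthant_def by auto

text \<open>The asymmetry comes from the boundary: scaling \<open>y\<close> up would leave its zero
  coordinates in place, so \<open>y\<close> moves along the diagonal, whereas zero coordinates of
  \<open>x\<close> are already bounded below by the orthant.\<close>

definition radial_pref :: "(real ^ 'n \<Rightarrow> real ^ 'n \<Rightarrow> bool) \<Rightarrow> bool" where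
  "radial_pref R \<longleftrightarrow> (\<forall>x\<in>nonneg_orthant. \<forall>y\<in>nonneg_orthant. strict R x y \<longrightarrow>
     (\<exists>s\<in>{0..<1}. strict R (s *\<^sub>R x) y) \<and> (\<exists>t>0. strict R x (y + vec t)))"

text \<open>Mixing \<open>x\<close> with the origin contracts it, and mixing \<open>y\<close> with
  \<open>y + vec 1\<close> shifts it along the diagonal.\<close>

lemma archimedean_imp_radial:
  fixes R :: "real ^ 'n \<Rightarrow> real ^ 'n \<Rightarrow> bool"
  assumes "archimedean_pref nonneg_orthant R"
  shows "radial_pref R"
  unfolding radial_pref_def
proof (intro ballI impI conjI)
  fix x y :: "real ^ 'n" assume X: "x \<in> nonneg_orthant" "y \<in> nonneg_orthant" and xy: "strict R x y"
  have "0 \<in> (nonneg_orthant :: (real ^ 'n) set)" by (simp add: nonneg_orthant_def)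
  then obtain s where "s \<in> {0<..<1}" "strict R (mix x s 0) y"
    using assms X xy unfolding archimedean_pref_def by meson
  then show "\<exists>s\<in>{0..<1}. strict R (s *\<^sub>R x) y"
    by (intro bexI[of _ s]) (auto simp: mix_def)
  have "y + vec 1 \<in> nonneg_orthant" using X(2) by (simp add: nonneg_orthant_def)
  then obtain t where t: "t \<in> {0<..<1}" "strict R x (mix y t (y + vec 1))"
    using assms X xy unfolding archimedean_pref_def by meson
  have "mix y t (y + vec 1) = y + vec (1 - t)"
    by (simp add: mix_def vec_eq_iff algebra_simps)
  then show "\<exists>t>0. strict R x (y + vec t)"
    using t by (intro exI[of _ "1 - t"]) auto
qed

section \<open>Complete, transitive and weakly monotonic preferences on the orthant\<close>

context
  fixes R :: "real ^ 'n \<Rightarrow> real ^ 'n \<Rightarrow> bool"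
  assumes cmp: "complete_pref nonneg_orthant R"
    and trns: "transp_on nonneg_orthant R"
    and mono: "weakly_monotonic nonneg_orthant R"
begin

text \<open>Weak monotonicity covers distinct points; completeness adds reflexivity.\<close>

lemma pref_of_ge:
  assumes "x \<in> nonneg_orthant" "y \<in> nonneg_orthant" "\<And>i. y $ i \<le> x $ i"
  shows "R x y"
  using assms cmp mono unfolding weakly_monotonic_def complete_pref_def by blast

lemma strict_pref_trans:
  assumes "x \<in> nonneg_orthant" "y \<in> nonneg_orthant" "z \<in> nonneg_orthant"
    and "R x y \<and> strict R y z \<or> strict R x y \<and> R y z"
  shows "strict R x z"
  using assms trns[unfolded transp_on_def, rule_format] unfolding strict_def by blast

text \<open>Order density gives \<open>z\<close> strictly between \<open>x\<close> and
  \<open>y\<close>. Points indifferent to \<open>z\<close> on the segment from the origin to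
  \<open>x\<close> and on the diagonal segment from \<open>y\<close> are the required witnesses,
  since strictness keeps them away from \<open>x\<close> and \<open>y\<close>.\<close>

lemma weakly_wold_imp_radial:
  assumes "weakly_wold_continuous nonneg_orthant R"
  shows "radial_pref R"
  unfolding radial_pref_def
proof (intro ballI impI)
  fix x y :: "real ^ 'n" assume X: "x \<in> nonneg_orthant" "y \<in> nonneg_orthant" and xy: "strict R x y"
  obtain z where z: "z \<in> nonneg_orthant" "strict R x z" "strict R z y"
    using assms X xy unfolding weakly_wold_continuous_def order_dense_def by blast
  have wold: "\<exists>w\<in>closed_segment a b. indiff R w z"
    if "a \<in> nonneg_orthant" "b \<in> nonneg_orthant" "strict R a z" "strict R z b" for a b
    using assms that z(1) unfolding weakly_wold_continuous_def by blast
  have 0: "0 \<in> (nonneg_orthant :: (real ^ 'n) set)" by (simp add: nonneg_orthant_def)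
  \<comment> \<open>By monotonicity the origin is weakly below \<open>y\<close>, hence strictly
    below \<open>z\<close>, so the segment from \<open>x\<close> to the origin must cross the level
    of \<open>z\<close>.\<close>
  have "R y 0" using X(2) 0 by (intro pref_of_ge) (auto simp: nonneg_orthant_def)
  then have "strict R z 0" using strict_pref_trans[OF z(1) X(2) 0] z by blast
  then obtain w where w: "w \<in> closed_segment 0 x" "indiff R w z"
    using wold[OF X(1) 0 z(2)] by (auto simp: closed_segment_commute)
  then obtain s where s: "w = s *\<^sub>R x" "0 \<le> s" "s \<le> 1" by (auto simp: closed_segment_def)
  have "s \<noteq> 1" using w(2) z(2) s(1) by (auto simp: indiff_def strict_def)
  moreover have "strict R w y"
    by (rule strict_pref_trans[of _ z]) (use w(2) z X s in \<open>auto simp: indiff_def nonneg_orthant_def\<close>)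
  ultimately have "\<exists>s\<in>{0..<1}. strict R (s *\<^sub>R x) y" using s by auto
  moreover have "\<exists>t>0. strict R x (y + vec t)"
  \<comment> \<open>Either the unit shift of \<open>y\<close> is still below \<open>x\<close> and
    \<open>t = 1\<close> works, or its endpoint is weakly above \<open>x\<close>, and the diagonal
    segment crosses the level of \<open>z\<close>.\<close>
  proof (cases "strict R x (y + vec 1)")
    case True
    then show ?thesis by (intro exI[of _ 1]) auto
  next
    case False
    let ?q = "y + vec 1"
    have q: "?q \<in> nonneg_orthant" using X(2) by (auto simp: nonneg_orthant_def)
    then have "R ?q x" using False cmp X(1) by (auto simp: strict_def complete_pref_def)
    then have "strict R ?q z" using strict_pref_trans[OF q X(1) z(1)] z by blast
    then obtain w where w: "w \<in> closed_segment y ?q" "indiff R w z"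
      using wold[OF q X(2) _ z(3)] by (auto simp: closed_segment_commute)
    then obtain t where t: "w = (1 - t) *\<^sub>R y + t *\<^sub>R ?q" "0 \<le> t" by (auto simp: closed_segment_def)
    have weq: "w = y + vec t" unfolding t(1) by (simp add: vec_eq_iff algebra_simps)
    have "w \<noteq> y" using w(2) z(3) by (auto simp: indiff_def strict_def)
    then have "t \<noteq> 0" using weq by (auto simp: vec_eq_iff)
    moreover have "strict R x w"
      by (rule strict_pref_trans[of _ z])
        (use w(2) z X weq t(2) in \<open>auto simp: indiff_def nonneg_orthant_def\<close>)
    ultimately show ?thesis using t(2) weq by (intro exI[of _ t]) auto
  qed
  ultimately show "(\<exists>s\<in>{0..<1}. strict R (s *\<^sub>R x) y) \<and> (\<exists>t>0. strict R x (y + vec t))" ..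
qed

text \<open>Monotonicity spreads strict preference from the single points
  \<open>s *\<^sub>R y\<close> and \<open>y + vec t\<close> to whole neighbourhoods of
  \<open>y\<close> in the orthant.\<close>

lemma radial_imp_continuous:
  assumes "radial_pref R"
  shows "continuous_pref nonneg_orthant R"
proof -
  let ?X = "nonneg_orthant :: (real ^ 'n) set"
  have up: "openin (top_of_set ?X) {y \<in> ?X. strict R y x}" if x: "x \<in> ?X" for x
  proof (subst openin_subopen, intro ballI)
    fix y assume "y \<in> {y \<in> ?X. strict R y x}"
    then have y: "y \<in> ?X" "strict R y x" by auto
    then obtain s where s: "s \<in> {0..<1}" "strict R (s *\<^sub>R y) x"
      using assms x unfolding radial_pref_def by blast
    \<comment> \<open>Only the positive coordinates of \<open>y\<close> are constrained, so
      \<open>y\<close> itself lies in this open set because \<open>s < 1\<close>; at the others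
      \<open>s * y $ i\<close> is 0, which bounds every point of the orthant from below.\<close>
    let ?W = "{z. \<forall>i. 0 < y $ i \<longrightarrow> s * y $ i < z $ i}"
    have "?W = (\<Inter>i\<in>{i. 0 < y $ i}. {z. s * y $ i < z $ i})" by auto
    then have "open ?W" by (auto intro!: open_INT open_halfspace_component_gt_cart)
    have sy: "s *\<^sub>R y \<in> ?X" using y s by (auto simp: nonneg_orthant_def)
    have "strict R z x" if "z \<in> ?X \<inter> ?W" for z
    proof (rule strict_pref_trans[of _ "s *\<^sub>R y"])
      have "s * y $ i \<le> z $ i" for i
        using that y(1) by (cases "y $ i = 0") (auto simp: nonneg_orthant_def order_le_less)
      then show "R z (s *\<^sub>R y) \<and> strict R (s *\<^sub>R y) x \<or> strict R z (s *\<^sub>R y) \<and> R (s *\<^sub>R y) x"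
        using that sy s by (auto intro: pref_of_ge)
    qed (use that sy x in auto)
    then show "\<exists>T. openin (top_of_set ?X) T \<and> y \<in> T \<and> T \<subseteq> {y \<in> ?X. strict R y x}"
      using \<open>open ?W\<close> y s by (intro exI[of _ "?X \<inter> ?W"]) (auto simp: openin_open)
  qed
  have down: "openin (top_of_set ?X) {y \<in> ?X. strict R x y}" if x: "x \<in> ?X" for x
  proof (subst openin_subopen, intro ballI)
    fix y assume "y \<in> {y \<in> ?X. strict R x y}"
    then have y: "y \<in> ?X" "strict R x y" by auto
    then obtain t where t: "t > 0" "strict R x (y + vec t)"
      using assms x unfolding radial_pref_def by blast
    let ?W = "{z. \<forall>i. z $ i < y $ i + t}"
    have "?W = (\<Inter>i\<in>UNIV. {z. z $ i < y $ i + t})" by auto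
    then have "open ?W" by (auto intro!: open_INT open_halfspace_component_lt_cart)
    have yt: "y + vec t \<in> ?X" using y t by (auto simp: nonneg_orthant_def)
    have "strict R x z" if "z \<in> ?X \<inter> ?W" for z
    proof (rule strict_pref_trans[of _ "y + vec t"])
      show "R x (y + vec t) \<and> strict R (y + vec t) z \<or> strict R x (y + vec t) \<and> R (y + vec t) z"
        using that yt t by (auto intro!: pref_of_ge less_imp_le)
    qed (use that yt x in auto)
    then show "\<exists>T. openin (top_of_set ?X) T \<and> y \<in> T \<and> T \<subseteq> {y \<in> ?X. strict R x y}"
      using \<open>open ?W\<close> y t by (intro exI[of _ "?X \<inter> ?W"]) (auto simp: openin_open)
  qed
  show ?thesis
    unfolding continuous_pref_def continuous_restr_def
  proof (intro ballI conjI)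
    fix x assume x: "x \<in> ?X"
    \<comment> \<open>By completeness the weak sections are complements of the opposite strict
      ones.\<close>
    have "section_at ?X R x \<inter> ?X = ?X - {y \<in> ?X. strict R x y}"
      "section_at ?X (R\<inverse>\<inverse>) x \<inter> ?X = ?X - {y \<in> ?X. strict R y x}"
      using cmp x by (auto simp: section_at_def strict_def complete_pref_def)
    then show "closedin (top_of_set ?X) (section_at ?X R x \<inter> ?X)"
      "closedin (top_of_set ?X) (section_at ?X (R\<inverse>\<inverse>) x \<inter> ?X)"
      using closedin_diff[OF closedin_topspace up[OF x]] closedin_diff[OF closedin_topspace down[OF x]]
      by simp_all
    have "section_at ?X (strict R) x \<inter> ?X = {y \<in> ?X. strict R y x}"
      "section_at ?X ((strict R)\<inverse>\<inverse>) x \<inter> ?X = {y \<in> ?X. strict R x y}"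
      by (auto simp: section_at_def)
    then show "openin (top_of_set ?X) (section_at ?X (strict R) x \<inter> ?X)"
      "openin (top_of_set ?X) (section_at ?X ((strict R)\<inverse>\<inverse>) x \<inter> ?X)"
      using up[OF x] down[OF x] by simp_all
  qed
qed

lemma radial_imp_utility:
  assumes "radial_pref R"
  shows "utility_representable nonneg_orthant R"
proof -
  obtain D :: "(real ^ 'n) set"
    where "countable D" "D \<subseteq> nonneg_orthant" "nonneg_orthant \<subseteq> closure D"
    by (rule separable)
  then show ?thesis
    using debreu[OF cmp trns convex_connected[OF convex_nonneg_orthant] radial_imp_continuous[OF assms]]
    by blast
qed

end

theorem corollary2:
  fixes R :: "real ^ 'n \<Rightarrow> real ^ 'n \<Rightarrow> bool"
    and P :: "(real ^ 'n) set \<Rightarrow> (real ^ 'n \<Rightarrow> real ^ 'n \<Rightarrow> bool) \<Rightarrow> bool"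
  assumes "complete_pref nonneg_orthant R"
    and "transp_on nonneg_orthant R"
    and "weakly_monotonic nonneg_orthant R"
    and "P \<in> {graph_continuous, continuous_pref, arc_continuous, linearly_continuous,
              mixture_continuous, archimedean_pref, wold_continuous, weakly_wold_continuous}"
  shows "utility_representable nonneg_orthant R \<longleftrightarrow> P nonneg_orthant R"
proof -
  let ?X = "nonneg_orthant :: (real ^ 'n) set"
  have cvx: "convex ?X" by (rule convex_nonneg_orthant)
  \<comment> \<open>Two cycles pass through utility and the radial property: one runs through graph
    continuity, continuity, its arc and linear versions, mixture continuity and the Archimedean
    property, the other through the two Wold properties.\<close>
  have "utility_representable ?X R \<Longrightarrow> graph_continuous ?X R"
    by (rule utility_imp_graph_continuous)
  moreover have "graph_continuous ?X R \<Longrightarrow> continuous_pref ?X R"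
    by (rule graph_continuous_imp_continuous)
  moreover have "continuous_pref ?X R \<Longrightarrow> arc_continuous ?X R"
    by (rule continuous_imp_arc_continuous)
  moreover have "continuous_pref ?X R \<Longrightarrow> linearly_continuous ?X R"
    by (rule continuous_imp_linearly_continuous)
  moreover have "arc_continuous ?X R \<Longrightarrow> mixture_continuous ?X R"
    by (rule arc_continuous_imp_mixture_continuous[OF _ cvx])
  moreover have "linearly_continuous ?X R \<Longrightarrow> mixture_continuous ?X R"
    by (rule linearly_continuous_imp_mixture_continuous[OF _ cvx])
  moreover have "mixture_continuous ?X R \<Longrightarrow> archimedean_pref ?X R"
    by (rule mixture_continuous_imp_archimedean[OF assms(1) _ cvx])
  moreover have "archimedean_pref ?X R \<Longrightarrow> radial_pref R"
    by (rule archimedean_imp_radial)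
  moreover have "utility_representable ?X R \<Longrightarrow> wold_continuous ?X R"
    by (rule utility_imp_wold_continuous[OF _ cvx])
  moreover have "wold_continuous ?X R \<Longrightarrow> weakly_wold_continuous ?X R"
    by (rule wold_imp_weakly_wold[OF _ cvx])
  moreover have "weakly_wold_continuous ?X R \<Longrightarrow> radial_pref R"
    by (rule weakly_wold_imp_radial[OF assms(1-3)])
  moreover have "radial_pref R \<Longrightarrow> utility_representable ?X R"
    by (rule radial_imp_utility[OF assms(1-3)])
  ultimately show ?thesis
    using assms(4) by blast
qed

end
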